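(* Let $0<s<1$ and $0<p<\infty$, and let $\emptyset\neq G\subsetneq \mathbb{R}^n$ be an open set. Then $G$ admits an $(s,p)$-Hardy inequality if and only if there is a constant $c>0$ such that $$\int_K \mathrm{dist}(x,\partial G)^{-sp}\,dx \le c\,\mathrm{cap}_{s,p}(K,G)$$ for every compact set $K\subset G$.
   Context: $C_c(G)$ denotes the space of (real-valued) continuous functions with compact support in $G$. For an open set $G\subset\mathbb{R}^n$ and a measurable function $u$ on $G$, put $$|u|_{W^{s,p}(G)}=\left(\int_G\int_G\frac{|u(x)-u(y)|^p}{|x-y|^{n+sp}}\,dy\,dx\right)^{1/p}\in[0,\infty].$$ An open set $\emptyset\neq G\subsetneq\mathbb{R}^n$ admits an $(s,p)$-Hardy inequality if there is a constant $C>0$ such that $$\int_G \frac{|u(x)|^p}{\mathrm{dist}(x,\partial G)^{sp}}\,dx\le C\,|u|_{W^{s,p}(G)}^p$$ for every $u\in C_c(G)$. For a compact set $K\subset G$, the $(s,p)$-capacity is $\mathrm{cap}_{s,p}(K,G)=\inf_u |u|_{W^{s,p}(G)}^p$, where the infimum ranges over all real-valued $u\in C_c(G)$ such that $u(x)\ge 1$ for every $x\in K$. *)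

theory Defs
  imports "HOL-Analysis.Analysis"
begin

text \<open>
  The space \<open>\<real>\<^sup>n\<close> is an arbitrary Euclidean space \<open>'a\<close> with \<open>n = DIM('a)\<close>.  A function on a set
  \<open>G\<close> is a total function on \<open>'a\<close> of which only the values on \<open>G\<close> are used.
\<close>

text \<open>
  The power \<open>a\<^sup>r\<close> of \<open>a \<in> [0,\<infinity>]\<close> for an exponent \<open>r > 0\<close>; only such exponents occur below.
\<close>

definition epowr :: "ennreal \<Rightarrow> real \<Rightarrow> ennreal"
  where "epowr a r = (if a = \<infinity> then \<infinity> else ennreal (enn2real a powr r))"

text \<open>
  On the diagonal \<open>x = y\<close> the integrand is \<open>0 / 0 = 0\<close>; the diagonal is a null set.
\<close>

definition gagliardo_seminorm :: "real \<Rightarrow> real \<Rightarrow> 'a::euclidean_space set \<Rightarrow> ('a \<Rightarrow> real) \<Rightarrow> ennreal"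
  where "gagliardo_seminorm s p G u =
    epowr (\<integral>\<^sup>+x\<in>G. (\<integral>\<^sup>+y\<in>G.
        ennreal (\<bar>u x - u y\<bar> powr p / norm (x - y) powr (real DIM('a) + s * p))
      \<partial>lborel) \<partial>lborel) (1 / p)"

text \<open>
  \<open>G \<inter> closure {x \<in> G. u x \<noteq> 0}\<close> is the support of \<open>u\<close> relative to \<open>G\<close>.
\<close>

definition Cc :: "'a::euclidean_space set \<Rightarrow> ('a \<Rightarrow> real) set"
  where "Cc G = {u. continuous_on G u \<and> compact (G \<inter> closure {x \<in> G. u x \<noteq> 0})}"

definition admits_Hardy :: "real \<Rightarrow> real \<Rightarrow> 'a::euclidean_space set \<Rightarrow> bool"
  where "admits_Hardy s p G \<longleftrightarrow> (\<exists>C::real. C > 0 \<and> (\<forall>u\<in>Cc G.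
    (\<integral>\<^sup>+x\<in>G. ennreal (\<bar>u x\<bar> powr p / infdist x (frontier G) powr (s * p)) \<partial>lborel)
      \<le> ennreal C * epowr (gagliardo_seminorm s p G u) p))"

definition frac_capacity :: "real \<Rightarrow> real \<Rightarrow> 'a::euclidean_space set \<Rightarrow> 'a set \<Rightarrow> ennreal"
  where "frac_capacity s p K G =
    (INF u \<in> {u \<in> Cc G. \<forall>x\<in>K. u x \<ge> 1}. epowr (gagliardo_seminorm s p G u) p)"

end

theory Submission
  imports Defs
begin

text \<open>
  Testing the Hardy inequality with a competitor for the capacity gives one implication.  Conversely,
  let \<open>\<bar>u\<bar> \<le> M\<close> and \<open>L\<^sub>k = M / 2\<^sup>k\<close>.  Maz'ya's truncations, which rise linearly from \<open>0\<close> to \<open>1\<close> as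
  \<open>\<bar>u\<bar>\<close> rises from \<open>L\<^sub>k\<^sub>+\<^sub>2\<close> to \<open>L\<^sub>k\<^sub>+\<^sub>1\<close>, are competitors for the capacities of the superlevel sets
  \<open>{\<bar>u\<bar> \<ge> L\<^sub>k\<^sub>+\<^sub>1}\<close>.  Their increments, weighted by \<open>L\<^sub>k\<close>, decay geometrically from the scale of
  \<open>max \<bar>u x\<bar> \<bar>u y\<bar>\<close> downwards, even when \<open>x\<close> and \<open>y\<close> lie in very different levels; hence the weighted
  energies sum up to at most a multiple of the energy of \<open>u\<close>, for every exponent \<open>p > 0\<close>.
\<close>

definition fractional_energy :: "real \<Rightarrow> real \<Rightarrow> 'a::euclidean_space set \<Rightarrow> ('a \<Rightarrow> real) \<Rightarrow> ennreal"
  where "fractional_energy s p G u = (\<integral>\<^sup>+x\<in>G. (\<integral>\<^sup>+y\<in>G.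
        ennreal (\<bar>u x - u y\<bar> powr p / norm (x - y) powr (real DIM('a) + s * p))
      \<partial>lborel) \<partial>lborel)"

text \<open>The ramp occupies the values from \<open>M / 2 ^ (k + 2)\<close> to its double
  \<open>M / 2 ^ (k + 1)\<close>. It thus lies directly below the band from
  \<open>M / 2 ^ (k + 1)\<close> to \<open>M / 2 ^ k\<close>, on which the truncation is already
  1.\<close>

definition dyadic_truncation :: "real \<Rightarrow> nat \<Rightarrow> real \<Rightarrow> real"
  where "dyadic_truncation M k t = max 0 (min 1 (t / (M / 2 ^ (k + 2)) - 1))"

section \<open>Removing the root from the seminorm\<close>

lemma epowr_inverse:
  assumes "0 < p"
  shows "epowr (epowr a (1 / p)) p = a"
proof (cases a rule: ennreal_cases)
  case (real r)
  then show ?thesis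
    using assms by (auto simp: epowr_def powr_powr)
qed (simp add: epowr_def)

lemma epowr_gagliardo_seminorm:
  assumes "0 < p"
  shows "epowr (gagliardo_seminorm s p G u) p = fractional_energy s p G u"
  using epowr_inverse[OF assms] by (simp add: gagliardo_seminorm_def fractional_energy_def)

section \<open>Dyadic levels and truncations\<close>

lemma dyadic_level_exists:
  fixes b M :: real
  assumes "0 < b" "b \<le> M"
  obtains j :: nat where "M / 2 ^ (j + 1) < b" "b \<le> M / 2 ^ j"
proof -
  let ?P = "\<lambda>n::nat. M / 2 ^ n < b"
  obtain n :: nat where "M / b < 2 ^ n"
    using real_arch_pow[of 2 "M / b"] by auto
  then have n: "?P n"
    using assms by (simp add: field_simps)
  define m where "m = (LEAST n. ?P n)"
  have m: "?P m"
    unfolding m_def using n by (rule LeastI)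
  \<comment> \<open>Since \<open>b \<le> M\<close>, the first level strictly below \<open>b\<close>
    is not level 0, so it has a predecessor, which is the wanted \<open>j\<close>.\<close>
  have "m \<noteq> 0"
    using m assms by (cases m) auto
  then obtain j where j: "m = Suc j"
    by (cases m) auto
  have "\<not> ?P j"
    using not_less_Least[of j ?P] j by (simp add: m_def)
  with m j show thesis
    by (intro that[of j]) auto
qed

lemma dyadic_truncation_bounds: "0 \<le> dyadic_truncation M k t" "dyadic_truncation M k t \<le> 1"
  by (auto simp: dyadic_truncation_def)

lemma dyadic_truncation_eq_0:
  assumes "0 < M" "t \<le> M / 2 ^ (k + 2)"
  shows "dyadic_truncation M k t = 0"
proof -
  have "t / (M / 2 ^ (k + 2)) \<le> 1"
    using assms by (subst divide_le_eq_1_pos) auto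
  then show ?thesis
    unfolding dyadic_truncation_def by linarith
qed

lemma dyadic_truncation_eq_1:
  assumes "0 < M" "M / 2 ^ (k + 1) \<le> t"
  shows "dyadic_truncation M k t = 1"
proof -
  have "2 \<le> t / (M / 2 ^ (k + 2))"
    using assms by (simp add: field_simps)
  then show ?thesis
    unfolding dyadic_truncation_def by linarith
qed

lemma dyadic_truncation_lipschitz:
  assumes "0 < M" "a \<le> b"
  shows "\<bar>dyadic_truncation M k b - dyadic_truncation M k a\<bar> \<le> (b - a) / (M / 2 ^ (k + 2))"
proof -
  have "a / (M / 2 ^ (k + 2)) \<le> b / (M / 2 ^ (k + 2))"
    using assms by (intro divide_right_mono) auto
  then show ?thesis
    unfolding dyadic_truncation_def diff_divide_distrib by linarith
qed

lemma continuous_on_dyadic_truncation [continuous_intros]: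
  assumes "continuous_on A f"
  shows "continuous_on A (\<lambda>x. dyadic_truncation M k (f x))"
  unfolding dyadic_truncation_def divide_inverse by (intro continuous_intros assms)

text \<open>Only the larger value \<open>b\<close> is located in a level; \<open>a\<close> may lie
  anywhere below it. A ramp above \<open>b\<close> sees neither value. For a ramp far below
  \<open>b\<close>, either \<open>a\<close> is above the ramp too and the increment vanishes, or
  \<open>b - a\<close> is at least \<open>M / 2 ^ (j + 2)\<close>, while the weight
  \<open>M / 2 ^ k\<close> decays in \<open>k\<close>.\<close>

lemma dyadic_truncation_increment_decay:
  fixes a b M :: real
  assumes M: "0 < M" and ab: "0 \<le> a" "a \<le> b"
    and j: "M / 2 ^ (j + 1) < b" "b \<le> M / 2 ^ j"
  shows "M / 2 ^ k * \<bar>dyadic_truncation M k b - dyadic_truncation M k a\<bar>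
    \<le> (if j \<le> k + 1 then 8 * (1 / 2) ^ (k + 1 - j) * (b - a) else 0)"
proof -
  let ?d = "\<bar>dyadic_truncation M k b - dyadic_truncation M k a\<bar>"
  have d1: "?d \<le> 1"
    using dyadic_truncation_bounds[of M k a] dyadic_truncation_bounds[of M k b] by linarith
  consider "k + 1 < j" | "k + 1 = j \<or> k = j" | m where "k + 1 = j + m" "m \<ge> 2"
  proof (cases "j \<le> k + 1")
    case True
    then obtain m where "k + 1 = j + m"
      using le_Suc_ex by blast
    then show thesis
      using that by (cases "m \<ge> 2") (auto simp: not_le less_2_cases_iff)
  qed (use that in auto)
  then show ?thesis
  proof cases
    case 1
    have "M / 2 ^ j \<le> M / 2 ^ (k + 2)"
      using 1 M by (intro divide_left_mono power_increasing) auto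
    then have "dyadic_truncation M k b = 0" "dyadic_truncation M k a = 0"
      using M ab j by (auto intro!: dyadic_truncation_eq_0)
    then show ?thesis
      using 1 by simp
  next
    case 2
    have "M / 2 ^ k * ?d \<le> M / 2 ^ k * ((b - a) / (M / 2 ^ (k + 2)))"
      using dyadic_truncation_lipschitz[OF M ab(2)] M by (intro mult_left_mono) auto
    also have "\<dots> = 4 * (b - a)"
      using M by (simp add: field_simps)
    \<comment> \<open>The exponent is 0 or 1 here, so the factor on the right is 8 or 4.\<close>
    also have "\<dots> \<le> 8 * (1 / 2) ^ (k + 1 - j) * (b - a)"
      using 2 ab by auto
    finally show ?thesis
      using 2 by auto
  next
    case (3 m)
    \<comment> \<open>As \<open>k = j + m - 1\<close>, passing from level \<open>k\<close> to level
      \<open>j + 2\<close> costs the factor \<open>2 ^ 3 / 2 ^ m\<close>; this is the origin of the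
      constant 8.\<close>
    have pw: "M / 2 ^ k = 8 * (1 / 2) ^ m * (M / 2 ^ (j + 2))"
    proof -
      have "(2::real) ^ k * 2 = 2 ^ j * 2 ^ m"
        using 3(1) by (metis power_add power_one_right)
      then show ?thesis
        using M by (simp add: field_simps power_divide)
    qed
    show ?thesis
    proof (cases "M / 2 ^ (j + 2) \<le> a")
      case True
      have "M / 2 ^ (k + 1) \<le> M / 2 ^ (j + 2)"
        using 3 M by (intro divide_left_mono power_increasing) auto
      then have "dyadic_truncation M k b = 1" "dyadic_truncation M k a = 1"
        using M ab True by (auto intro!: dyadic_truncation_eq_1)
      then show ?thesis
        using ab by simp
    next
      case False
      have "M / 2 ^ (j + 1) = 2 * (M / 2 ^ (j + 2))"
        by simp
      then have ba: "M / 2 ^ (j + 2) \<le> b - a"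
        using False j(1) by linarith
      have "M / 2 ^ k * ?d \<le> M / 2 ^ k * 1"
        using M d1 by (intro mult_left_mono) auto
      also have "\<dots> \<le> 8 * (1 / 2) ^ m * (b - a)"
        unfolding mult_1_right pw using ba by (rule mult_left_mono) simp
      finally show ?thesis
        using 3 by simp
    qed
  qed
qed

section \<open>Summation of the weighted increments over all levels\<close>

lemma sum_shifted_geometric_le:
  fixes q :: real
  assumes "0 \<le> q" "q < 1"
  shows "(\<Sum>k<n. if j \<le> k + 1 then q ^ (k + 1 - j) else 0) \<le> 1 / (1 - q)"
proof -
  let ?A = "{k \<in> {..<n}. j \<le> k + 1}"
  have "(\<Sum>k<n. if j \<le> k + 1 then q ^ (k + 1 - j) else 0) = (\<Sum>k\<in>?A. q ^ (k + 1 - j))"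
    by (rule sum.inter_filter[symmetric]) simp
  \<comment> \<open>On \<open>?A\<close> the subtraction is not truncated, so the exponents are
    distinct and the sum is part of one full geometric series, whatever \<open>j\<close> and
    \<open>n\<close> are.\<close>
  also have "\<dots> = sum ((^) q) ((\<lambda>k. k + 1 - j) ` ?A)"
    by (subst sum.reindex) (auto simp: inj_on_def)
  also have "\<dots> \<le> (\<Sum>m. q ^ m)"
    using assms by (intro sum_le_suminf summable_geometric) auto
  also have "\<dots> = 1 / (1 - q)"
    using assms by (intro suminf_geometric) auto
  finally show ?thesis .
qed

text \<open>The decay estimate is raised to the power \<open>p\<close> term by term, which leaves a
  geometric series of ratio \<open>(1 / 2) powr p\<close>. No power of a sum is ever expanded, so
  exponents below 1 need no separate argument.\<close>

lemma suminf_dyadic_truncation_increments_ordered: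
  fixes a b M p :: real
  assumes M: "0 < M" and p: "0 < p" and ab: "0 \<le> a" "a \<le> b" "b \<le> M"
  shows "(\<Sum>k. ennreal ((M / 2 ^ k) powr p
      * \<bar>dyadic_truncation M k b - dyadic_truncation M k a\<bar> powr p))
    \<le> ennreal (8 powr p / (1 - (1 / 2) powr p) * (b - a) powr p)"
proof (cases "b = 0")
  \<comment> \<open>The value 0 lies in no dyadic level; here \<open>a = b = 0\<close> and every
    term vanishes.\<close>
  case True
  then show ?thesis
    using ab by simp
next
  case False
  let ?d = "\<lambda>k. \<bar>dyadic_truncation M k b - dyadic_truncation M k a\<bar>"
  define q :: real where "q = (1 / 2) powr p"
  have q: "0 \<le> q" "q < 1"
    using p powr_less_mono2[of p "1 / 2" 1] by (auto simp: q_def)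
  obtain j where j: "M / 2 ^ (j + 1) < b" "b \<le> M / 2 ^ j"
    using dyadic_level_exists[of b M] False ab by auto
  let ?g = "\<lambda>k. if j \<le> k + 1 then q ^ (k + 1 - j) else 0"
  have term_le: "(M / 2 ^ k) powr p * ?d k powr p \<le> 8 powr p * (b - a) powr p * ?g k" for k
  proof -
    have "(M / 2 ^ k) powr p * ?d k powr p = (M / 2 ^ k * ?d k) powr p"
      by (rule powr_mult[symmetric])
    also have "\<dots> \<le> (if j \<le> k + 1 then 8 * (1 / 2) ^ (k + 1 - j) * (b - a) else 0) powr p"
      using dyadic_truncation_increment_decay[OF M ab(1,2) j, of k] M p by (intro powr_mono2) auto
    also have "\<dots> = 8 powr p * (b - a) powr p * ?g k"
    proof -
      have "((1 / 2) ^ m) powr p = q ^ m" for m :: nat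
        unfolding q_def by (simp add: powr_realpow[symmetric] powr_powr mult.commute)
      then show ?thesis
        using ab p by (auto simp: powr_mult mult_ac)
    qed
    finally show ?thesis .
  qed
  have "(\<Sum>k<n. ennreal ((M / 2 ^ k) powr p * ?d k powr p))
      \<le> ennreal (8 powr p / (1 - q) * (b - a) powr p)" for n
  proof -
    have "(\<Sum>k<n. (M / 2 ^ k) powr p * ?d k powr p) \<le> (\<Sum>k<n. 8 powr p * (b - a) powr p * ?g k)"
      by (intro sum_mono term_le)
    also have "\<dots> = 8 powr p * (b - a) powr p * (\<Sum>k<n. ?g k)"
      by (rule sum_distrib_left[symmetric])
    also have "\<dots> \<le> 8 powr p * (b - a) powr p * (1 / (1 - q))"
      using sum_shifted_geometric_le[OF q] by (intro mult_left_mono) auto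
    finally show ?thesis
      by (subst sum_ennreal) (auto intro!: ennreal_leI simp: mult_ac)
  qed
  then show ?thesis
    unfolding q_def suminf_eq_SUP by (intro SUP_least) auto
qed

lemma suminf_dyadic_truncation_increments:
  fixes a b M p :: real
  assumes M: "0 < M" and p: "0 < p" and ab: "\<bar>a\<bar> \<le> M" "\<bar>b\<bar> \<le> M"
  shows "(\<Sum>k. ennreal ((M / 2 ^ k) powr p
      * \<bar>dyadic_truncation M k \<bar>a\<bar> - dyadic_truncation M k \<bar>b\<bar>\<bar> powr p))
    \<le> ennreal (8 powr p / (1 - (1 / 2) powr p) * \<bar>a - b\<bar> powr p)"
proof -
  define l u where "l = min \<bar>a\<bar> \<bar>b\<bar>" and "u = max \<bar>a\<bar> \<bar>b\<bar>"
  have "(1 / 2) powr p < (1::real)"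
    using p powr_less_mono2[of p "1 / 2" 1] by auto
  have eq: "\<bar>dyadic_truncation M k \<bar>a\<bar> - dyadic_truncation M k \<bar>b\<bar>\<bar>
      = \<bar>dyadic_truncation M k u - dyadic_truncation M k l\<bar>" for k
    by (auto simp: l_def u_def max_def min_def abs_minus_commute)
  have "(\<Sum>k. ennreal ((M / 2 ^ k) powr p
      * \<bar>dyadic_truncation M k \<bar>a\<bar> - dyadic_truncation M k \<bar>b\<bar>\<bar> powr p))
    \<le> ennreal (8 powr p / (1 - (1 / 2) powr p) * (u - l) powr p)"
    unfolding eq using assms
    by (intro suminf_dyadic_truncation_increments_ordered) (auto simp: l_def u_def)
  \<comment> \<open>The reverse triangle inequality: \<open>u - l\<close> is the distance between
    the absolute values of \<open>a\<close> and \<open>b\<close>.\<close>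
  also have "\<dots> \<le> ennreal (8 powr p / (1 - (1 / 2) powr p) * \<bar>a - b\<bar> powr p)"
    using p \<open>(1 / 2) powr p < 1\<close>
    by (intro ennreal_leI mult_left_mono powr_mono2) (auto simp: l_def u_def)
  finally show ?thesis .
qed

section \<open>Summation of energies\<close>

lemma fractional_energy_cong:
  assumes "\<And>x. x \<in> G \<Longrightarrow> u x = v x"
  shows "fractional_energy s p G u = fractional_energy s p G v"
  unfolding fractional_energy_def
  by (intro nn_integral_cong) (auto simp: assms indicator_def intro!: nn_integral_cong)

text \<open>The pointwise inequality is multiplied by the kernel and integrated twice; by monotone
  convergence, series of nonnegative measurable functions commute with both integrals.\<close>

lemma suminf_fractional_energy_le_measurable:
  fixes G :: "'a::euclidean_space set" and w :: "nat \<Rightarrow> 'a \<Rightarrow> real"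
  assumes [measurable]: "G \<in> sets borel" "u \<in> borel_measurable borel"
      "\<And>k. w k \<in> borel_measurable borel"
    and nonneg: "\<And>k. 0 \<le> c k" "0 \<le> D"
    and le: "\<And>x y. x \<in> G \<Longrightarrow> y \<in> G \<Longrightarrow>
      (\<Sum>k. ennreal (c k * \<bar>w k x - w k y\<bar> powr p)) \<le> ennreal (D * \<bar>u x - u y\<bar> powr p)"
  shows "(\<Sum>k. ennreal (c k) * fractional_energy s p G (w k)) \<le> ennreal D * fractional_energy s p G u"
proof -
  define N where "N = (\<lambda>x y::'a. norm (x - y) powr (real DIM('a) + s * p))"
  have [measurable]: "case_prod N \<in> borel_measurable (borel \<Otimes>\<^sub>M borel)"
    unfolding N_def by measurable
  let ?f = "\<lambda>v x y. ennreal (\<bar>v x - v y\<bar> powr p / N x y) * indicator G y"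
  have ptw: "(\<Sum>k. ennreal (c k) * ?f (w k) x y) \<le> ennreal D * ?f u x y" if x: "x \<in> G" for x y
  proof (cases "y \<in> G")
    case True
    \<comment> \<open>The diagonal is no exception: there \<open>N x y = 0\<close>, and both the
      quotients and \<open>1 / N x y\<close> are 0.\<close>
    have "(\<Sum>k. ennreal (c k) * ?f (w k) x y)
        = (\<Sum>k. ennreal (c k * \<bar>w k x - w k y\<bar> powr p) * ennreal (1 / N x y))"
      using True nonneg by (simp add: ennreal_mult'[symmetric] N_def)
    also have "\<dots> = (\<Sum>k. ennreal (c k * \<bar>w k x - w k y\<bar> powr p)) * ennreal (1 / N x y)"
      by simp
    also have "\<dots> \<le> ennreal (D * \<bar>u x - u y\<bar> powr p) * ennreal (1 / N x y)"
      by (intro mult_right_mono le x True) simp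
    also have "\<dots> = ennreal D * ?f u x y"
      using True nonneg by (simp add: ennreal_mult'[symmetric] N_def)
    finally show ?thesis .
  qed simp
  have inner: "(\<Sum>k. ennreal (c k) * (\<integral>\<^sup>+y. ?f (w k) x y \<partial>lborel))
      \<le> ennreal D * (\<integral>\<^sup>+y. ?f u x y \<partial>lborel)" if x: "x \<in> G" for x
  proof -
    have [measurable]: "N x \<in> borel_measurable borel"
      unfolding N_def by measurable
    have "(\<Sum>k. ennreal (c k) * (\<integral>\<^sup>+y. ?f (w k) x y \<partial>lborel))
        = (\<integral>\<^sup>+y. (\<Sum>k. ennreal (c k) * ?f (w k) x y) \<partial>lborel)"
      by (subst nn_integral_suminf) (auto simp: nn_integral_cmult)
    also have "\<dots> \<le> (\<integral>\<^sup>+y. ennreal D * ?f u x y \<partial>lborel)"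
      by (intro nn_integral_mono ptw x)
    finally show ?thesis
      by (simp add: nn_integral_cmult)
  qed
  let ?F = "\<lambda>v x. (\<integral>\<^sup>+y. ?f v x y \<partial>lborel) * indicator G x"
  \<comment> \<open>Joint measurability of the integrand makes the inner integral measurable in
    \<open>x\<close>, as the exchange with the outer integral requires.\<close>
  have meas: "?F v \<in> borel_measurable lborel" if [measurable]: "v \<in> borel_measurable borel" for v
    by measurable
  have "(\<Sum>k. ennreal (c k) * fractional_energy s p G (w k))
      = (\<Sum>k. ennreal (c k) * (\<integral>\<^sup>+x. ?F (w k) x \<partial>lborel))"
    by (simp add: fractional_energy_def N_def)
  also have "\<dots> = (\<integral>\<^sup>+x. (\<Sum>k. ennreal (c k) * ?F (w k) x) \<partial>lborel)"
    using meas by (subst nn_integral_suminf) (auto simp: nn_integral_cmult)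
  also have "\<dots> \<le> (\<integral>\<^sup>+x. ennreal D * ?F u x \<partial>lborel)"
  proof (intro nn_integral_mono)
    fix x
    show "(\<Sum>k. ennreal (c k) * ?F (w k) x) \<le> ennreal D * ?F u x"
      using inner[of x] by (cases "x \<in> G") auto
  qed
  also have "\<dots> = ennreal D * fractional_energy s p G u"
    using meas[of u] by (simp add: nn_integral_cmult fractional_energy_def N_def)
  finally show ?thesis .
qed

text \<open>A function continuous on \<open>G\<close> may be non-measurable as a total function. Its
  extension by zero is Borel and has the same energy.\<close>

lemma suminf_fractional_energy_le:
  fixes G :: "'a::euclidean_space set" and w :: "nat \<Rightarrow> 'a \<Rightarrow> real"
  assumes G: "G \<in> sets borel" and cont: "continuous_on G u" "\<And>k. continuous_on G (w k)"
    and nonneg: "\<And>k. 0 \<le> c k" "0 \<le> D"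
    and le: "\<And>x y. x \<in> G \<Longrightarrow> y \<in> G \<Longrightarrow>
      (\<Sum>k. ennreal (c k * \<bar>w k x - w k y\<bar> powr p)) \<le> ennreal (D * \<bar>u x - u y\<bar> powr p)"
  shows "(\<Sum>k. ennreal (c k) * fractional_energy s p G (w k)) \<le> ennreal D * fractional_energy s p G u"
proof -
  let ?e = "\<lambda>v x. indicator G x *\<^sub>R v x :: real"
  have eq: "fractional_energy s p G v = fractional_energy s p G (?e v)" for v
    by (intro fractional_energy_cong) auto
  show ?thesis
    unfolding eq[of u] eq[of "w _"]
  proof (rule suminf_fractional_energy_le_measurable)
    show "?e u \<in> borel_measurable borel" "?e (w k) \<in> borel_measurable borel" for k
      by (rule borel_measurable_continuous_on_indicator[OF G] cont)+
    show "(\<Sum>k. ennreal (c k * \<bar>?e (w k) x - ?e (w k) y\<bar> powr p))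
        \<le> ennreal (D * \<bar>?e u x - ?e u y\<bar> powr p)" if "x \<in> G" "y \<in> G" for x y
      using le[OF that] that by (simp only: indicator_simps scaleR_one)
  qed (fact G nonneg)+
qed

section \<open>Bounds, superlevel sets and truncations of functions in \<open>Cc\<close>\<close>

lemma Cc_bounded:
  assumes "u \<in> Cc G"
  obtains M where "0 < M" "\<And>x. x \<in> G \<Longrightarrow> \<bar>u x\<bar> \<le> M"
proof -
  let ?S = "G \<inter> closure {x \<in> G. u x \<noteq> 0}"
  have "continuous_on ?S u" "compact ?S"
    using assms by (auto simp: Cc_def intro: continuous_on_subset)
  then have "bounded (u ` ?S)"
    by (intro compact_imp_bounded compact_continuous_image)
  then obtain M where M: "0 < M" "\<And>x. x \<in> ?S \<Longrightarrow> \<bar>u x\<bar> \<le> M"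
    unfolding bounded_pos by auto
  have "\<bar>u x\<bar> \<le> M" if "x \<in> G" for x
  proof (cases "u x = 0")
    case False
    then have "x \<in> ?S"
      using that closure_subset[of "{x \<in> G. u x \<noteq> 0}"] by auto
    then show ?thesis
      by (rule M)
  qed (use M in auto)
  with M(1) show thesis
    by (rule that)
qed

text \<open>Because \<open>t\<close> is positive, the set lies in the compact relative support of
  \<open>u\<close>, and continuity makes it closed there. The capacity estimate is applied to these
  sets.\<close>

lemma compact_superlevel_set_Cc:
  assumes "u \<in> Cc G" "0 < t"
  shows "compact {x \<in> G. t \<le> \<bar>u x\<bar>}"
proof -
  let ?S = "G \<inter> closure {x \<in> G. u x \<noteq> 0}"
  have S: "continuous_on ?S u" "compact ?S"
    using assms by (auto simp: Cc_def intro: continuous_on_subset)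
  have "{x \<in> G. t \<le> \<bar>u x\<bar>} = {x \<in> ?S. t \<le> \<bar>u x\<bar>}"
    using assms(2) closure_subset[of "{x \<in> G. u x \<noteq> 0}"] by auto
  also have "\<dots> = ?S \<inter> (\<lambda>x. \<bar>u x\<bar>) -` {t..}"
    by auto
  also have "compact \<dots>"
  proof -
    have "closedin (top_of_set ?S) (?S \<inter> (\<lambda>x. \<bar>u x\<bar>) -` {t..})"
      using S by (intro continuous_closedin_preimage continuous_intros) auto
    then show ?thesis
      using S(2) closedin_compact by blast
  qed
  finally show ?thesis .
qed

lemma dyadic_truncation_in_Cc:
  assumes "u \<in> Cc G" "0 < M"
  shows "(\<lambda>x. dyadic_truncation M k \<bar>u x\<bar>) \<in> Cc G"
proof -
  let ?A = "{x \<in> G. dyadic_truncation M k \<bar>u x\<bar> \<noteq> 0}" and ?B = "{x \<in> G. u x \<noteq> 0}"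
  have cont: "continuous_on G u" and supp: "compact (G \<inter> closure ?B)"
    using assms(1) by (simp_all add: Cc_def)
  have "?A \<subseteq> ?B"
    using assms(2) by (auto simp: dyadic_truncation_eq_0)
  then have "closure ?A \<subseteq> closure ?B"
    by (rule closure_mono)
  \<comment> \<open>Since \<open>G\<close> need not be closed, compactness is inherited from the
    relative support of \<open>u\<close>, cut by a closed set.\<close>
  then have "G \<inter> closure ?A = (G \<inter> closure ?B) \<inter> closure ?A"
    by auto
  also have "compact \<dots>"
    by (rule compact_Int_closed[OF supp closed_closure])
  finally have "compact (G \<inter> closure ?A)" .
  then show ?thesis
    using cont by (auto simp: Cc_def intro!: continuous_intros)
qed

section \<open>The two implications\<close>

lemma Hardy_imp_capacity:
  fixes G :: "'a::euclidean_space set"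
  assumes "0 < p" "0 < C" "K \<subseteq> G"
    and Hardy: "\<And>u. u \<in> Cc G \<Longrightarrow>
      (\<integral>\<^sup>+x\<in>G. ennreal (\<bar>u x\<bar> powr p / infdist x (frontier G) powr (s * p)) \<partial>lborel)
        \<le> ennreal C * epowr (gagliardo_seminorm s p G u) p"
  shows "(\<integral>\<^sup>+x\<in>K. ennreal (infdist x (frontier G) powr (- (s * p))) \<partial>lborel)
    \<le> ennreal C * frac_capacity s p K G"
proof -
  let ?I = "\<integral>\<^sup>+x\<in>K. ennreal (infdist x (frontier G) powr (- (s * p))) \<partial>lborel"
  have le: "?I \<le> ennreal C * epowr (gagliardo_seminorm s p G u) p"
    if u: "u \<in> Cc G" "\<forall>x\<in>K. 1 \<le> u x" for u
  proof -
    have "?I \<le> (\<integral>\<^sup>+x\<in>G. ennreal (\<bar>u x\<bar> powr p / infdist x (frontier G) powr (s * p)) \<partial>lborel)"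
    proof (intro nn_integral_mono)
      fix x
      show "ennreal (infdist x (frontier G) powr (- (s * p))) * indicator K x
        \<le> ennreal (\<bar>u x\<bar> powr p / infdist x (frontier G) powr (s * p)) * indicator G x"
      proof (cases "x \<in> K")
        case True
        then have "1 powr p \<le> \<bar>u x\<bar> powr p"
          using u assms(1) by (intro powr_mono2) force+
        then show ?thesis
          using True subsetD[OF assms(3) True]
          by (auto simp: powr_minus_divide intro!: ennreal_leI divide_right_mono)
      qed simp
    qed
    also note Hardy[OF u(1)]
    finally show ?thesis .
  qed
  \<comment> \<open>Dividing by \<open>C\<close> leaves a lower bound for the energies of all
    competitors, hence for their infimum. Multiplying back is exact because \<open>C\<close> is
    positive and finite.\<close>
  have "?I / ennreal C \<le> frac_capacity s p K G"
    unfolding frac_capacity_def using le assms(2)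
    by (intro INF_greatest) (auto simp: divide_le_posI_ennreal mult.commute)
  then have "ennreal C * (?I / ennreal C) \<le> ennreal C * frac_capacity s p K G"
    by (rule mult_left_mono) simp
  moreover have "ennreal C * (?I / ennreal C) = ?I"
    using mult_divide_eq_ennreal[of "ennreal C" ?I] assms(2)
    by (simp add: ennreal_times_divide mult.commute)
  ultimately show ?thesis
    by simp
qed

text \<open>The Hardy constant is the product of the capacity constant \<open>c\<close> and the
  factor lost in summing the energies of the truncations.\<close>

lemma capacity_imp_Hardy:
  fixes G :: "'a::euclidean_space set"
  assumes p: "0 < p" and G: "open G" and c: "0 < c"
    and cap: "\<And>K. compact K \<Longrightarrow> K \<subseteq> G \<Longrightarrow>
      (\<integral>\<^sup>+x\<in>K. ennreal (infdist x (frontier G) powr (- (s * p))) \<partial>lborel)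
        \<le> ennreal c * frac_capacity s p K G"
    and u: "u \<in> Cc G"
  shows "(\<integral>\<^sup>+x\<in>G. ennreal (\<bar>u x\<bar> powr p / infdist x (frontier G) powr (s * p)) \<partial>lborel)
    \<le> ennreal (c * (8 powr p / (1 - (1 / 2) powr p))) * epowr (gagliardo_seminorm s p G u) p"
proof -
  define D :: real where "D = 8 powr p / (1 - (1 / 2) powr p)"
  have "(1 / 2) powr p < (1::real)"
    using p powr_less_mono2[of p "1 / 2" 1] by auto
  then have D: "0 \<le> D"
    by (simp add: D_def)
  obtain M where M: "0 < M" "\<And>x. x \<in> G \<Longrightarrow> \<bar>u x\<bar> \<le> M"
    using Cc_bounded[OF u] by blast
  let ?d = "\<lambda>x. infdist x (frontier G)"
  \<comment> \<open>\<open>L k\<close> already contains the power \<open>p\<close>: it bounds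
    \<open>\<bar>u x\<bar> powr p\<close> on the band below \<open>M / 2 ^ k\<close>, and
    \<open>K k\<close> contains the points of that band.\<close>
  define L where "L = (\<lambda>k::nat. (M / 2 ^ k) powr p)"
  define K where "K = (\<lambda>k::nat. {x \<in> G. M / 2 ^ (k + 1) \<le> \<bar>u x\<bar>})"
  define w where "w = (\<lambda>k x. dyadic_truncation M k \<bar>u x\<bar>)"
  have K: "compact (K k)" "K k \<subseteq> G" for k
    unfolding K_def using compact_superlevel_set_Cc[OF u] M(1) by auto
  have [measurable]: "K k \<in> sets borel" for k
    using K by (intro borel_closed compact_imp_closed)
  have [measurable]: "?d \<in> borel_measurable borel"
    by (intro borel_measurable_continuous_onI continuous_intros)
  have w: "w k \<in> Cc G" for k
    unfolding w_def by (intro dyadic_truncation_in_Cc u M)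
  have "(\<integral>\<^sup>+x\<in>G. ennreal (\<bar>u x\<bar> powr p / ?d x powr (s * p)) \<partial>lborel)
      \<le> (\<integral>\<^sup>+x. (\<Sum>k. ennreal (L k) * (ennreal (?d x powr (- (s * p))) * indicator (K k) x)) \<partial>lborel)"
  proof (intro nn_integral_mono)
    fix x
    let ?h = "\<lambda>k. ennreal (L k) * (ennreal (?d x powr (- (s * p))) * indicator (K k) x)"
    show "ennreal (\<bar>u x\<bar> powr p / ?d x powr (s * p)) * indicator G x \<le> (\<Sum>k. ?h k)"
    proof (cases "x \<in> G \<and> u x \<noteq> 0")
      case True
      \<comment> \<open>One term of the series is enough, the one whose band contains
        \<open>\<bar>u x\<bar>\<close>.\<close>
      then obtain k where k: "M / 2 ^ (k + 1) < \<bar>u x\<bar>" "\<bar>u x\<bar> \<le> M / 2 ^ k"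
        using dyadic_level_exists[of "\<bar>u x\<bar>" M] M(2)[of x] by auto
      have "\<bar>u x\<bar> powr p \<le> L k"
        unfolding L_def using k p by (intro powr_mono2) auto
      then have "ennreal (\<bar>u x\<bar> powr p / ?d x powr (s * p)) * indicator G x
          \<le> ennreal (L k * ?d x powr (- (s * p)))"
        using True by (auto simp: powr_minus_divide intro!: ennreal_leI divide_right_mono)
      also have "\<dots> = ?h k"
        using True k(1) by (simp add: K_def L_def ennreal_mult')
      also have "\<dots> \<le> (\<Sum>k. ?h k)"
        using sum_le_suminf[of ?h "{k}"] by simp
      finally show ?thesis .
    qed (use p in auto)
  qed
  also have "\<dots> = (\<Sum>k. ennreal (L k) * (\<integral>\<^sup>+x\<in>K k. ennreal (?d x powr (- (s * p))) \<partial>lborel))"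
    by (subst nn_integral_suminf) (auto simp: nn_integral_cmult)
  also have "\<dots> \<le> (\<Sum>k. ennreal c * (ennreal (L k) * fractional_energy s p G (w k)))"
  proof (intro suminf_le summableI)
    fix k
    \<comment> \<open>The ramp of \<open>w k\<close> ends at the level that defines
      \<open>K k\<close>, so \<open>w k\<close> is 1 there and competes for the capacity.\<close>
    have "frac_capacity s p (K k) G \<le> epowr (gagliardo_seminorm s p G (w k)) p"
      unfolding frac_capacity_def
      using w M(1) by (intro INF_lower) (auto simp: w_def K_def dyadic_truncation_eq_1)
    then have "ennreal c * frac_capacity s p (K k) G \<le> ennreal c * fractional_energy s p G (w k)"
      unfolding epowr_gagliardo_seminorm[OF p] by (intro mult_left_mono) auto
    then have "(\<integral>\<^sup>+x\<in>K k. ennreal (?d x powr (- (s * p))) \<partial>lborel)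
        \<le> ennreal c * fractional_energy s p G (w k)"
      using cap[OF K, of k] by (rule order_trans[rotated])
    then have "ennreal (L k) * (\<integral>\<^sup>+x\<in>K k. ennreal (?d x powr (- (s * p))) \<partial>lborel)
        \<le> ennreal (L k) * (ennreal c * fractional_energy s p G (w k))"
      by (intro mult_left_mono) auto
    then show "ennreal (L k) * (\<integral>\<^sup>+x\<in>K k. ennreal (?d x powr (- (s * p))) \<partial>lborel)
        \<le> ennreal c * (ennreal (L k) * fractional_energy s p G (w k))"
      by (simp add: mult_ac)
  qed
  also have "\<dots> = ennreal c * (\<Sum>k. ennreal (L k) * fractional_energy s p G (w k))"
    by simp
  also have "\<dots> \<le> ennreal c * (ennreal D * fractional_energy s p G u)"
  proof (intro mult_left_mono suminf_fractional_energy_le)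
    show "continuous_on G u" "continuous_on G (w k)" for k
      using u w[of k] by (auto simp: Cc_def)
    show "(\<Sum>k. ennreal (L k * \<bar>w k x - w k y\<bar> powr p)) \<le> ennreal (D * \<bar>u x - u y\<bar> powr p)"
      if "x \<in> G" "y \<in> G" for x y
      unfolding L_def w_def D_def
      by (intro suminf_dyadic_truncation_increments M that p)
  qed (use D G in \<open>auto simp: L_def\<close>)
  also have "\<dots> = ennreal (c * D) * epowr (gagliardo_seminorm s p G u) p"
    using c D by (simp add: epowr_gagliardo_seminorm[OF p] ennreal_mult mult_ac)
  finally show ?thesis
    by (simp only: D_def)
qed

theorem theorem1:
  fixes s p :: real and G :: "'a::euclidean_space set"
  assumes "0 < s" and "s < 1" and "0 < p"
    and "open G" and "G \<noteq> {}" and "G \<noteq> UNIV"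
  shows "admits_Hardy s p G \<longleftrightarrow>
    (\<exists>c::real. c > 0 \<and> (\<forall>K. compact K \<and> K \<subseteq> G \<longrightarrow>
      (\<integral>\<^sup>+x\<in>K. ennreal (infdist x (frontier G) powr (- (s * p))) \<partial>lborel)
        \<le> ennreal c * frac_capacity s p K G))"
    (is "_ \<longleftrightarrow> ?cap")
proof
  assume "admits_Hardy s p G"
  then obtain C where "0 < C" "\<And>u. u \<in> Cc G \<Longrightarrow>
      (\<integral>\<^sup>+x\<in>G. ennreal (\<bar>u x\<bar> powr p / infdist x (frontier G) powr (s * p)) \<partial>lborel)
        \<le> ennreal C * epowr (gagliardo_seminorm s p G u) p"
    unfolding admits_Hardy_def by blast
  then show ?cap
    using Hardy_imp_capacity[OF assms(3)] by blast
next
  assume ?cap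
  then obtain c where c: "0 < c" "\<And>K. compact K \<Longrightarrow> K \<subseteq> G \<Longrightarrow>
      (\<integral>\<^sup>+x\<in>K. ennreal (infdist x (frontier G) powr (- (s * p))) \<partial>lborel)
        \<le> ennreal c * frac_capacity s p K G"
    by blast
  have "(1 / 2) powr p < (1::real)"
    using assms(3) powr_less_mono2[of p "1 / 2" 1] by auto
  then have "0 < c * (8 powr p / (1 - (1 / 2) powr p))"
    using c(1) by simp
  then show "admits_Hardy s p G"
    unfolding admits_Hardy_def using capacity_imp_Hardy[OF assms(3,4) c] by blast
qed

end
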